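(* For each $i \in \mathbb{N}$ let $X_i$ be a Polish space, and let $X = \prod_{i \in \mathbb{N}} X_i$ with the product topology. For each product Borel probability measure $\sigma = \bigotimes_{i\in\mathbb{N}} \sigma_i$ on $X$ (with $\sigma_i$ a Borel probability measure on $X_i$ for each $i$) and each bounded Borel-measurable function $f : X \to \mathbb{R}$, the set $W_0(\sigma,f)$ of weak $0$-approximations of the expectation of $f$ under $\sigma$ has $\sigma$-measure $1$.
   Context: $\mathbb{N} = \{1,2,\ldots\}$. A point $x_i \in X_i$ is also used to denote the Dirac measure on $X_i$ concentrated at $x_i$. $\mathbb{E}_\tau[f]$ denotes the expectation of $f$ under the probability measure $\tau$. Definition. For $\epsilon \ge 0$, a point $x = (x_i)_{i\in\mathbb{N}} \in X$ is a weak $\epsilon$-approximation of the expectation of $f$ under $\sigma$ if there exist $n \in \mathbb{N}$ and a Borel probability measure $\tau_i$ on $X_i$ for each $i < n$ such that $$\big|\mathbb{E}_{\tau_1 \otimes \cdots \otimes \tau_{n-1} \otimes x_n \otimes x_{n+1} \otimes \cdots}[f] - \mathbb{E}_\sigma[f]\big| \le \epsilon.$$ $W_\epsilon(\sigma,f) \subseteq X$ denotes the set of weak $\epsilon$-approximations of the expectation of $f$ under $\sigma$. The symbol $\sigma$ also denotes the unique extension of the measure $\sigma$ to the sigma-algebra of all universally measurable subsets of $X$ (those measurable with respect to the completion of every Borel probability measure on $X$); the set $W_0(\sigma,f)$ is analytic, hence universally measurable, and its $\sigma$-measure is understood in this sense. *)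

theory Defs
  imports "HOL-Probability.Probability"
begin

text \<open>The spaces are abstract topologies with their own carriers rather than instances of the
  class \<^class>\<open>polish_space\<close>, so that the factors of a product may differ from one another.\<close>

definition Polish_space :: "'a topology \<Rightarrow> bool" where
  "Polish_space X \<longleftrightarrow> completely_metrizable_space X \<and> separable_space X"

definition borel_of :: "'a topology \<Rightarrow> 'a measure" where
  "borel_of X = sigma (topspace X) {U. openin X U}"

definition borel_prob :: "'a topology \<Rightarrow> 'a measure \<Rightarrow> bool" where
  "borel_prob X \<mu> \<longleftrightarrow> prob_space \<mu> \<and> sets \<mu> = sets (borel_of X)"

text \<open>Only the \<open>\<sigma>\<close>-algebra of \<open>universal_algebra X\<close> matters. The condition
  \<open>A \<subseteq> topspace X\<close> is implied by the other one unless there is no Borel probability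
  measure at all, that is, unless the space is empty.\<close>

definition universal_algebra :: "'a topology \<Rightarrow> 'a measure" where
  "universal_algebra X = sigma (topspace X)
     {A. A \<subseteq> topspace X \<and> (\<forall>\<mu>. borel_prob X \<mu> \<longrightarrow> A \<in> sets (completion \<mu>))}"

definition universal_extension :: "'a topology \<Rightarrow> 'a measure \<Rightarrow> 'a measure" where
  "universal_extension X \<mu> = restr_to_subalg (completion \<mu>) (universal_algebra X)"

text \<open>The coordinates are numbered from \<open>0\<close>: the first \<open>n\<close> coordinates are the ones whose law is
  chosen freely, and \<open>n = 0\<close> means that none is. The measure \<open>\<mu>\<close> lives on the whole product.\<close>

definition weak_approx ::
  "(nat \<Rightarrow> 'a topology) \<Rightarrow> real \<Rightarrow> (nat \<Rightarrow> 'a) measure \<Rightarrow> ((nat \<Rightarrow> 'a) \<Rightarrow> real) \<Rightarrow> (nat \<Rightarrow> 'a) set" where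
  "weak_approx X \<epsilon> \<mu> f =
     {x \<in> topspace (product_topology X UNIV).
        \<exists>n. \<exists>\<tau> :: nat \<Rightarrow> 'a measure.
          (\<forall>i<n. borel_prob (X i) (\<tau> i)) \<and>
          \<bar>(\<integral>y. f y \<partial>(\<Pi>\<^sub>M i\<in>UNIV. if i < n then \<tau> i else return (borel_of (X i)) (x i)))
            - (\<integral>y. f y \<partial>\<mu>)\<bar> \<le> \<epsilon>}"

lemma space_borel_of [simp]: "space (borel_of X) = topspace X"
  by (simp add: borel_of_def space_measure_of_conv)

lemma sets_borel_of: "sets (borel_of X) = sigma_sets (topspace X) {U. openin X U}"
  unfolding borel_of_def by (rule sets_measure_of) (auto dest: openin_subset)

lemma openin_sets_borel_of: "openin X U \<Longrightarrow> U \<in> sets (borel_of X)"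
  by (simp add: sets_borel_of sigma_sets.Basic)

lemma borel_prob_space_eq: "borel_prob X \<mu> \<Longrightarrow> space \<mu> = topspace X"
  by (metis borel_prob_def sets_eq_imp_space_eq space_borel_of)

lemma Polish_space_imp_second_countable:
  assumes "Polish_space X"
  shows "second_countable X"
proof -
  obtain M d where "Metric_space M d" and X: "X = Metric_space.mtopology M d"
    using assms completely_metrizable_imp_metrizable_space
    unfolding Polish_space_def metrizable_space_def by metis
  then interpret Metric_space M d by simp
  obtain C where C: "countable C" "C \<subseteq> M" "mtopology closure_of C = M"
    using assms unfolding Polish_space_def separable_space_def X by auto
  let ?B = "(\<lambda>(c, k::nat). mball c (1 / Suc k)) ` (C \<times> UNIV)"
  show ?thesis
    unfolding second_countable_def
  proof (intro exI conjI)
    show "countable ?B"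
      using C by simp
    show "\<forall>V\<in>?B. openin X V"
      by (auto simp: X)
    show "\<forall>U x. openin X U \<and> x \<in> U \<longrightarrow> (\<exists>V\<in>?B. x \<in> V \<and> V \<subseteq> U)"
    proof (intro allI impI)
      fix U x
      assume U: "openin X U \<and> x \<in> U"
      then obtain r where r: "r > 0" "mball x r \<subseteq> U" and xM: "x \<in> M"
        unfolding X openin_mtopology by blast
      obtain k :: nat where k: "1 / Suc k < r / 2"
        using nat_approx_posE[of "r/2"] r(1) by auto
      have "x \<in> mtopology closure_of C"
        using C xM by simp
      moreover have "(0::real) < 1 / Suc k"
        by simp
      ultimately obtain c where c: "c \<in> C" "c \<in> mball x (1 / Suc k)"
        unfolding metric_closure_of by blast
      have "mball c (1 / Suc k) \<subseteq> mball x r"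
      proof
        fix y
        assume y: "y \<in> mball c (1 / Suc k)"
        have "d x y \<le> d x c + d c y"
          using y c C xM by (intro triangle) auto
        then show "y \<in> mball x r"
          using y c k xM by auto
      qed
      moreover have "x \<in> mball c (1 / Suc k)"
        using c xM by (auto simp: commute)
      ultimately show "\<exists>V\<in>?B. x \<in> V \<and> V \<subseteq> U"
        using c r by (intro bexI[of _ "mball c (1 / Suc k)"]) auto
    qed
  qed
qed

text \<open>The product \<open>\<sigma>\<close>-algebra is the Borel \<open>\<sigma>\<close>-algebra of the product topology, so \<^const>\<open>PiM\<close>
  yields Borel measures on the product space.\<close>

lemma sets_PiM_borel_of:
  fixes X :: "nat \<Rightarrow> 'a topology"
  assumes P: "\<And>i. Polish_space (X i)"
  shows "sets (\<Pi>\<^sub>M i\<in>UNIV. borel_of (X i)) = sets (borel_of (product_topology X UNIV))"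
proof
  let ?T = "product_topology X UNIV"
  let ?N = "\<Pi>\<^sub>M i\<in>UNIV. borel_of (X i)"
  show "sets ?N \<subseteq> sets (borel_of ?T)"
  proof (rule sets_PiM_in_sets)
    show "space (borel_of ?T) = (\<Pi>\<^sub>E i\<in>UNIV. space (borel_of (X i)))"
      by simp
    fix i A
    assume A: "A \<in> sets (borel_of (X i))"
    have "(\<lambda>x. x i) \<in> borel_of ?T \<rightarrow>\<^sub>M borel_of (X i)"
      unfolding borel_of_def[of "X i"]
    proof (rule measurable_measure_of)
      show "{U. openin (X i) U} \<subseteq> Pow (topspace (X i))"
        by (auto dest: openin_subset)
      show "(\<lambda>x. x i) \<in> space (borel_of ?T) \<rightarrow> topspace (X i)"
        by auto
      fix U
      assume "U \<in> {U. openin (X i) U}"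
      then have "openin ?T {x \<in> topspace ?T. x i \<in> U}"
        using continuous_map_product_coordinates[of i UNIV X]
        unfolding continuous_map_def by auto
      then have "{x \<in> topspace ?T. x i \<in> U} \<in> sets (borel_of ?T)"
        by (rule openin_sets_borel_of)
      moreover have "(\<lambda>x. x i) -` U \<inter> space (borel_of ?T) = {x \<in> topspace ?T. x i \<in> U}"
        by auto
      ultimately show "(\<lambda>x. x i) -` U \<inter> space (borel_of ?T) \<in> sets (borel_of ?T)"
        by simp
    qed
    from measurable_sets[OF this A] show "{x \<in> space (borel_of ?T). x i \<in> A} \<in> sets (borel_of ?T)"
      by (simp add: vimage_def Int_def conj_commute)
  qed
  have "\<exists>B. \<forall>i. countable (B i) \<and> (\<forall>V\<in>B i. openin (X i) V) \<and>
      (\<forall>U x. openin (X i) U \<and> x \<in> U \<longrightarrow> (\<exists>V\<in>B i. x \<in> V \<and> V \<subseteq> U))"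
    using Polish_space_imp_second_countable[OF P] unfolding second_countable_def by (intro choice) blast
  then obtain B where B: "\<And>i. countable (B i)" "\<And>i V. V \<in> B i \<Longrightarrow> openin (X i) V"
    "\<And>i U x. openin (X i) U \<Longrightarrow> x \<in> U \<Longrightarrow> \<exists>V\<in>B i. x \<in> V \<and> V \<subseteq> U"
    by metis
  define cyl where "cyl J V = {x \<in> topspace ?T. \<forall>i\<in>J. x i \<in> V i}" for J :: "nat set" and V :: "nat \<Rightarrow> 'a set"
  define K where "K = (\<Union>J\<in>{J. finite J}. cyl J ` (\<Pi>\<^sub>E i\<in>J. B i))"
  have K: "countable K"
    unfolding K_def
  proof (rule countable_UN)
    show "countable {J :: nat set. finite J}"
      by (rule countable_Collect_finite)
    show "countable (cyl J ` (\<Pi>\<^sub>E i\<in>J. B i))" if "J \<in> {J. finite J}" for J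
      using that B(1) by (intro countable_image countable_PiE) auto
  qed
  have KN: "k \<in> sets ?N" if k: "k \<in> K" for k
  proof -
    obtain J V where J: "finite J" "V \<in> (\<Pi>\<^sub>E i\<in>J. B i)" "k = cyl J V"
      using k unfolding K_def by blast
    have [measurable]: "V i \<in> sets (borel_of (X i))" if "i \<in> J" for i
      using J that B(2) by (intro openin_sets_borel_of) auto
    have "{x \<in> space ?N. x i \<in> V i} \<in> sets ?N" if "i \<in> J" for i
      using that by measurable
    then have "{x \<in> space ?N. \<forall>i\<in>J. x i \<in> V i} \<in> sets ?N"
      using J(1) by (rule sets.sets_Collect_finite_All)
    moreover have "k = {x \<in> space ?N. \<forall>i\<in>J. x i \<in> V i}"
      by (simp add: J cyl_def space_PiM)
    ultimately show ?thesis
      by simp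
  qed
  show "sets (borel_of ?T) \<subseteq> sets ?N"
  proof -
    have "U \<in> sets ?N" if U: "openin ?T U" for U
    proof -
      have "\<exists>k\<in>K. x \<in> k \<and> k \<subseteq> U" if x: "x \<in> U" for x
      proof -
        obtain W where W: "finite {i. W i \<noteq> topspace (X i)}" "\<And>i. openin (X i) (W i)"
          "x \<in> Pi\<^sub>E UNIV W" "Pi\<^sub>E UNIV W \<subseteq> U"
          using U x unfolding openin_product_topology_alt by auto
        let ?J = "{i. W i \<noteq> topspace (X i)}"
        have "\<exists>V\<in>B i. x i \<in> V \<and> V \<subseteq> W i" for i
        proof (rule B(3))
          show "openin (X i) (W i)"
            by (rule W(2))
          show "x i \<in> W i"
            using W(3) by blast
        qed
        then obtain V where V: "\<And>i. V i \<in> B i" "\<And>i. x i \<in> V i" "\<And>i. V i \<subseteq> W i"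
          by metis
        have sub: "cyl ?J (restrict V ?J) \<subseteq> Pi\<^sub>E UNIV W"
        proof
          fix y
          assume y: "y \<in> cyl ?J (restrict V ?J)"
          have "y i \<in> W i" for i
            using y V(3)[of i] unfolding cyl_def by (cases "i \<in> ?J") auto
          then show "y \<in> Pi\<^sub>E UNIV W"
            by auto
        qed
        have "x \<in> topspace ?T"
          using x U openin_subset by blast
        then have mem: "x \<in> cyl ?J (restrict V ?J)"
          using V(2) unfolding cyl_def by auto
        moreover have "cyl ?J (restrict V ?J) \<in> K"
          unfolding K_def using W(1) V(1) by auto
        ultimately show ?thesis
          using subset_trans[OF sub W(4)] mem by (intro bexI[of _ "cyl ?J (restrict V ?J)"] conjI)
      qed
      then have "U = \<Union>{k \<in> K. k \<subseteq> U}"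
        by blast
      moreover have "\<Union>{k \<in> K. k \<subseteq> U} \<in> sets ?N"
      proof (rule sets.countable_Union)
        show "countable {k \<in> K. k \<subseteq> U}"
          using K by (rule countable_subset[rotated]) simp
        show "{k \<in> K. k \<subseteq> U} \<subseteq> sets ?N"
          using KN by blast
      qed
      ultimately show ?thesis
        by simp
    qed
    moreover have "topspace ?T = space ?N"
      by (simp add: space_PiM)
    ultimately show ?thesis
      unfolding sets_borel_of by (auto intro!: sets.sigma_sets_subset)
  qed
qed

lemma borel_prob_PiM:
  fixes X :: "nat \<Rightarrow> 'a topology"
  assumes "\<And>i. Polish_space (X i)" "\<And>i. borel_prob (X i) (\<sigma> i)"
  shows "borel_prob (product_topology X UNIV) (PiM UNIV \<sigma>)"
proof -
  have "prob_space (PiM UNIV \<sigma>)"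
    using assms(2) by (intro prob_space_PiM) (auto simp: borel_prob_def)
  moreover have "sets (PiM UNIV \<sigma>) = sets (\<Pi>\<^sub>M i\<in>UNIV. borel_of (X i))"
    using assms(2) by (intro sets_PiM_cong) (auto simp: borel_prob_def)
  ultimately show ?thesis
    using sets_PiM_borel_of[OF assms(1)] by (simp add: borel_prob_def)
qed

text \<open>The extension has exactly the universally measurable sets as its measurable sets, and on
  them its values are those of the completion.\<close>

lemma sets_universal_algebra:
  "sets (universal_algebra X) =
     {A. A \<subseteq> topspace X \<and> (\<forall>\<mu>. borel_prob X \<mu> \<longrightarrow> A \<in> sets (completion \<mu>))}" (is "_ = ?U")
proof -
  have "sigma_algebra (topspace X) ?U"
    unfolding sigma_algebra_iff2
  proof (intro conjI ballI allI impI)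
    show "?U \<subseteq> Pow (topspace X)"
      by auto
    show "{} \<in> ?U"
      by auto
    show "topspace X - A \<in> ?U" if "A \<in> ?U" for A
    proof -
      have "topspace X - A \<in> sets (completion \<mu>)" if "borel_prob X \<mu>" for \<mu>
      proof -
        have "space (completion \<mu>) - A \<in> sets (completion \<mu>)"
          using \<open>A \<in> ?U\<close> that by (intro sets.compl_sets) auto
        then show ?thesis
          using borel_prob_space_eq[OF that] by simp
      qed
      then show ?thesis
        by auto
    qed
    show "\<Union>(range A) \<in> ?U" if A: "range A \<subseteq> ?U" for A :: "nat \<Rightarrow> 'a set"
    proof -
      have "\<Union>(range A) \<in> sets (completion \<mu>)" if "borel_prob X \<mu>" for \<mu>
        using A that by (intro sets.countable_UN) blast
      then show ?thesis
        using A by blast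
    qed
  qed
  then show ?thesis
    unfolding universal_algebra_def by (simp add: sigma_algebra.sets_measure_of_eq)
qed

lemma subalgebra_universal_algebra:
  assumes "borel_prob X \<mu>"
  shows "subalgebra (completion \<mu>) (universal_algebra X)"
  unfolding subalgebra_def sets_universal_algebra
  using assms borel_prob_space_eq[OF assms] by (auto simp: universal_algebra_def space_measure_of_conv)

lemma sets_universal_extension:
  "borel_prob X \<mu> \<Longrightarrow> sets (universal_extension X \<mu>) = sets (universal_algebra X)"
  unfolding universal_extension_def by (intro sets_restr_to_subalg subalgebra_universal_algebra)

lemma emeasure_universal_extension:
  "borel_prob X \<mu> \<Longrightarrow> A \<in> sets (universal_algebra X) \<Longrightarrow>
    emeasure (universal_extension X \<mu>) A = emeasure (completion \<mu>) A"
  unfolding universal_extension_def by (intro emeasure_restr_to_subalg subalgebra_universal_algebra)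

end

theory Submission
  imports Defs
begin

text \<open>Let \<open>c\<close> be the expectation of \<open>f\<close> under \<open>\<sigma>\<close>, and call two points of the product tail equivalent if
  they agree from some coordinate on. The weak \<open>0\<close>-approximations are exactly the points \<open>x\<close> whose
  tail class contains a point where \<open>f \<le> c\<close> and a point where \<open>f \<ge> c\<close>.

  Suppose that \<open>y\<close> and \<open>z\<close> are such points. Replacing the coordinates of \<open>y\<close> by those of \<open>z\<close> one at a
  time leads from \<open>y\<close> to \<open>z\<close> in finitely many steps, and in one of these steps \<open>f\<close> passes from a value
  \<open>\<le> c\<close> to a value \<open>\<ge> c\<close>. The product of Dirac measures in all the other coordinates with a suitable
  two-point measure in the coordinate changed by that step gives \<open>f\<close> the expectation \<open>c\<close>
  (\<open>weak_approx_of_crossing\<close>). If on the contrary \<open>f > c\<close> on the whole tail class of \<open>x\<close>, then every product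
  measure that is Dirac at \<open>x\<close> from some coordinate on lives on this class, so gives \<open>f\<close> an expectation
  \<open>> c\<close> (\<open>weak_approx_lower_point\<close>). Replacing \<open>f\<close> by \<open>-f\<close> exchanges the two inequalities.

  Hence it suffices that almost every tail class meets \<open>{f \<le> c}\<close>. The set of points whose tail class
  lies inside \<open>B = {f > c}\<close> is invariant under tail equivalence, and \<open>B\<close> does not have full measure,
  since \<open>f\<close> would then have an expectation \<open>> c\<close>. A zero-one law thus makes it a null set. This set is
  in general only coanalytic, so the law has to be proved in the form that it is contained in a
  measurable null set (\<open>subset_tail_null\<close>).

  Universal measurability comes from descriptive set theory. Borel sets are projections of closed sets
  along the Baire space (\<open>analytic_in_borel\<close>); adding one more projection, the union of the tail
  classes that meet a Borel set is a countable union of projections of closed sets along a Polish space; and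
  such projections are universally measurable (\<open>projection_closedin_in_completion\<close>), because
  completions of finite measures are closed under the Souslin operation
  (\<open>Souslin_scheme_in_completion\<close>).\<close>

section \<open>Polish spaces\<close>

lemma Polish_space_metrizable: "Polish_space X \<Longrightarrow> metrizable_space X"
  by (simp add: Polish_space_def completely_metrizable_imp_metrizable_space)

lemma Polish_space_discrete_nat: "Polish_space (discrete_topology (UNIV :: nat set))"
  by (auto simp: Polish_space_def completely_metrizable_space_discrete_topology
      separable_space_discrete_topology)

lemma Polish_space_prod_topology:
  assumes "Polish_space X" "Polish_space Y"
  shows "Polish_space (prod_topology X Y)"
proof -
  obtain C D where "countable C" "C \<subseteq> topspace X" "X closure_of C = topspace X"
    "countable D" "D \<subseteq> topspace Y" "Y closure_of D = topspace Y"
    using assms unfolding Polish_space_def separable_space_def by metis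
  then have "separable_space (prod_topology X Y)"
    unfolding separable_space_def
    by (intro exI[of _ "C \<times> D"]) (auto simp: closure_of_Times)
  then show ?thesis
    using assms by (auto simp: Polish_space_def completely_metrizable_space_prod_topology)
qed

lemma Polish_space_product_topology:
  fixes X :: "nat \<Rightarrow> 'a topology"
  assumes P: "\<And>i. Polish_space (X i)" and ne: "\<And>i. topspace (X i) \<noteq> {}"
  shows "Polish_space (product_topology X UNIV)"
proof -
  have "\<exists>C. \<forall>i. countable (C i) \<and> C i \<subseteq> topspace (X i) \<and> X i closure_of (C i) = topspace (X i)"
    using P unfolding Polish_space_def separable_space_def by (intro choice) blast
  then obtain C where C: "\<And>i. countable (C i)" "\<And>i. C i \<subseteq> topspace (X i)"
    "\<And>i. X i closure_of (C i) = topspace (X i)"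
    by metis
  have "\<exists>a. \<forall>i. a i \<in> C i"
    using C(3) ne by (intro choice) (metis closure_of_empty ex_in_conv)
  then obtain a where a: "\<And>i. a i \<in> C i"
    by blast
  define D where "D = (\<Union>J\<in>{J. finite J}. (\<lambda>y i. if i \<in> J then y i else a i) ` (\<Pi>\<^sub>E i\<in>J. C i))"
  have "countable D"
    unfolding D_def
    by (intro countable_UN countable_image countable_PiE C countable_Collect_finite) auto
  moreover have D: "D \<subseteq> topspace (product_topology X UNIV)"
    using C(2) a by (fastforce simp: D_def PiE_iff)
  moreover have "product_topology X UNIV closure_of D = topspace (product_topology X UNIV)"
  proof (intro dense_intersects_open[THEN iffD2] allI impI)
    fix U
    assume U: "openin (product_topology X UNIV) U \<and> U \<noteq> {}"
    then obtain x where "x \<in> U"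
      by blast
    then obtain W where W: "finite {i. W i \<noteq> topspace (X i)}" "\<And>i. openin (X i) (W i)"
      "x \<in> Pi\<^sub>E UNIV W" "Pi\<^sub>E UNIV W \<subseteq> U"
      using U unfolding openin_product_topology_alt by fastforce
    have "\<exists>v\<in>C i. v \<in> W i" for i
      using C(3)[of i] W(2)[of i] W(3) openin_subset[OF W(2)[of i]] unfolding closure_of_def by blast
    then obtain v where v: "\<And>i. v i \<in> C i" "\<And>i. v i \<in> W i"
      by metis
    \<comment> \<open>Only the finitely many coordinates that \<open>W\<close> constrains differ from the base point \<open>a\<close>.\<close>
    let ?J = "{i. W i \<noteq> topspace (X i)}"
    let ?z = "\<lambda>i. if i \<in> ?J then restrict v ?J i else a i"
    have "restrict v ?J \<in> (\<Pi>\<^sub>E i\<in>?J. C i)"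
      using v(1) by (rule restrict_PiE_iff[THEN iffD2, rule_format])
    then have "?z \<in> D"
      unfolding D_def using W(1) by blast
    moreover have "?z \<in> Pi\<^sub>E UNIV W"
      using v subsetD[OF C(2) a] by (auto simp: PiE_iff)
    ultimately show "D \<inter> U \<noteq> {}"
      using W(4) by blast
  qed
  ultimately have "separable_space (product_topology X UNIV)"
    unfolding separable_space_def by blast
  moreover have "completely_metrizable_space (product_topology X UNIV)"
    using P by (simp add: completely_metrizable_space_product_topology Polish_space_def)
  ultimately show ?thesis
    by (simp add: Polish_space_def)
qed

lemma closedin_sets_borel_of: "closedin X C \<Longrightarrow> C \<in> sets (borel_of X)"
  using sets.compl_sets[OF openin_sets_borel_of[of X "topspace X - C"]] closedin_subset[of X C]
  by (simp add: openin_diff double_diff)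

section \<open>Analytic sets are universally measurable\<close>

text \<open>The Lusin-Sierpinski argument. Envelopes \<open>E u\<close> of the \<open>A u\<close> can be chosen inside \<open>C u\<close>, and
  then \<open>E u\<close> exceeds the union of the \<open>E (u @ [k])\<close> by a null set only. Outside these countably
  many null sets, a point of \<open>E []\<close> lies in \<open>E (u @ [k])\<close> for some \<open>k\<close> whenever it lies in \<open>E u\<close>, and so
  follows an infinite branch, which puts it into \<open>A []\<close>. Thus \<open>A []\<close> differs from its envelope by a
  null set.\<close>

lemma Souslin_scheme_in_completion:
  fixes A C :: "nat list \<Rightarrow> 'a set"
  assumes fin: "finite_measure M"
    and C: "\<And>u. C u \<in> sets M" and AC: "\<And>u. A u \<subseteq> C u"
    and split: "\<And>u. A u \<subseteq> (\<Union>k. A (u @ [k]))"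
    and branch: "\<And>s. (\<Inter>n. C (map s [0..<n])) \<subseteq> A []"
  shows "A [] \<in> sets (completion M)"
proof -
  interpret finite_measure M by fact
  have "\<exists>E\<subseteq>C u. measurable_envelope M (A u) E" for u
    using measurable_envelopeI_countable_cover[of "A u" "\<lambda>_. C u" M] AC C
    by (simp add: less_top[symmetric])
  then obtain E where EC: "\<And>u. E u \<subseteq> C u" and E: "\<And>u. measurable_envelope M (A u) (E u)"
    by metis
  note ED = measurable_envelopeD[OF E]
  define N where "N u = E u - (\<Union>k. E (u @ [k]))" for u
  have "N u \<in> null_sets M" for u
  proof (rule null_setsI)
    show "N u \<in> sets M"
      unfolding N_def using ED(2) by (intro sets.Diff sets.countable_UN) auto
    moreover have "N u \<subseteq> E u - A u"
      using split[of u] ED(1) by (auto simp: N_def)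
    ultimately show "emeasure M (N u) = 0"
      by (rule measurable_envelopeD1[OF E])
  qed
  then have null: "(\<Union>u. N u) \<in> null_sets M"
    by (intro null_sets_UN)
  have "E [] - A [] \<subseteq> (\<Union>u. N u)"
  proof
    fix x
    assume x: "x \<in> E [] - A []"
    show "x \<in> (\<Union>u. N u)"
    proof (rule ccontr)
      assume "x \<notin> (\<Union>u. N u)"
      then have "\<exists>k. x \<in> E u \<longrightarrow> x \<in> E (u @ [k])" for u
        by (auto simp: N_def)
      then obtain g where g: "\<And>u. x \<in> E u \<Longrightarrow> x \<in> E (u @ [g u])"
        by metis
      define U where "U = rec_nat [] (\<lambda>_ u. u @ [g u])"
      have U: "U 0 = []" "U (Suc n) = U n @ [g (U n)]" for n
        by (auto simp: U_def)
      have xU: "x \<in> E (U n)" for n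
        using x by (induction n) (auto simp: U g)
      define s where "s n = g (U n)" for n
      have eq: "map s [0..<n] = U n" for n
        by (induction n) (auto simp: U s_def)
      have "x \<in> C (map s [0..<n])" for n
        unfolding eq using xU[of n] EC[of "U n"] by (rule subsetD[rotated])
      then have "x \<in> (\<Inter>n. C (map s [0..<n]))"
        by (rule INT_I)
      then show False
        using branch x by blast
    qed
  qed
  then have "E [] - A [] \<in> sets (completion M)"
    by (rule sets_completionI_sub[OF null])
  then have "E [] - (E [] - A []) \<in> sets (completion M)"
    by (rule sets.Diff[OF sets_completionI_sets[OF ED(2)]])
  moreover have "E [] - (E [] - A []) = A []"
    using ED(1)[of "[]"] by blast
  ultimately show ?thesis
    by simp
qed

text \<open>The Souslin scheme comes from covering \<open>P\<close>, at stage \<open>n\<close>, by countably many balls of radius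
  \<open>2\<^sup>-\<^sup>n\<close>: a finite sequence \<open>u\<close> selects one ball at each stage, and \<open>A u\<close> consists of the points of the
  projection that have a witness in all the selected balls. Along a branch the witnesses form a
  Cauchy sequence; as \<open>P\<close> is complete and \<open>R\<close> closed, a point in all the closures of the \<open>A u\<close> has
  the limit as a witness.\<close>

lemma projection_closedin_in_completion:
  assumes X: "metrizable_space X" and P: "Polish_space P"
    and R: "closedin (prod_topology X P) R"
    and \<mu>: "borel_prob X \<mu>"
  shows "fst ` R \<in> sets (completion \<mu>)"
proof (cases "topspace P = {}")
  case True
  then have "R = {}"
    using closedin_subset[OF R] by auto
  then show ?thesis
    by simp
next
  case False
  obtain MX dX where "Metric_space MX dX" and Xeq: "X = Metric_space.mtopology MX dX"
    using X unfolding metrizable_space_def by metis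
  then interpret X: Metric_space MX dX by simp
  obtain MP dP where "Metric_space MP dP" and Peq: "P = Metric_space.mtopology MP dP"
    and "Metric_space.mcomplete MP dP"
    using P unfolding Polish_space_def completely_metrizable_space_def by metis
  then interpret P: Metric_space MP dP by simp
  obtain D where D: "countable D" "D \<subseteq> MP" "P.mtopology closure_of D = MP"
    using P unfolding Polish_space_def separable_space_def Peq by auto
  have "D \<noteq> {}"
    using False D by (auto simp: Peq)
  then obtain c :: "nat \<Rightarrow> _" where c: "range c = D"
    using D(1) uncountable_def by metis
  have cM: "c k \<in> MP" for k
    using c D(2) by blast
  have RM: "x \<in> MX" "p \<in> MP" if "(x, p) \<in> R" for x p
    using closedin_subset[OF R] that by (auto simp: Xeq Peq)
  have dense: "\<exists>k. dP (c k) p < r" if p: "p \<in> MP" and "r > 0" for p r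
  proof -
    have "p \<in> P.mtopology closure_of D"
      using p D(3) by simp
    then obtain y where "y \<in> D" "y \<in> P.mball p r"
      using \<open>r > 0\<close> unfolding P.metric_closure_of by blast
    then show ?thesis
      using c by (auto simp: P.commute)
  qed
  define B where "B u = {p. \<forall>i<length u. dP (c (u ! i)) p < (1/2)^i}" for u
  define A where "A u = {x. \<exists>p\<in>B u. (x, p) \<in> R}" for u
  interpret prob_space \<mu>
    using \<mu> by (simp add: borel_prob_def)
  have "A [] \<in> sets (completion \<mu>)"
  proof (rule Souslin_scheme_in_completion)
    show "finite_measure \<mu>"
      by (rule finite_measure_axioms)
    fix u
    show "X closure_of A u \<in> sets \<mu>"
      using closedin_sets_borel_of[of X "X closure_of A u"] \<mu> by (simp add: borel_prob_def)
    show "A u \<subseteq> X closure_of A u"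
      by (rule closure_of_subset) (use RM in \<open>auto simp: A_def Xeq\<close>)
    show "A u \<subseteq> (\<Union>k. A (u @ [k]))"
    proof
      fix x
      assume "x \<in> A u"
      then obtain p where p: "p \<in> B u" "(x, p) \<in> R"
        by (auto simp: A_def)
      obtain k where "dP (c k) p < (1/2)^length u"
        using dense[OF RM(2)[OF p(2)], of "(1/2)^length u"] by auto
      then have "p \<in> B (u @ [k])"
        using p(1) by (auto simp: B_def nth_append less_Suc_eq)
      then show "x \<in> (\<Union>k. A (u @ [k]))"
        using p(2) by (auto simp: A_def)
    qed
  next
    fix s :: "nat \<Rightarrow> nat"
    show "(\<Inter>n. X closure_of A (map s [0..<n])) \<subseteq> A []"
    proof
      fix x
      assume x: "x \<in> (\<Inter>n. X closure_of A (map s [0..<n]))"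
      have "\<exists>y p. (y, p) \<in> R \<and> p \<in> B (map s [0..<n]) \<and> dX x y < (1/2)^n \<and> x \<in> MX" for n
      proof -
        have "x \<in> X closure_of A (map s [0..<n])"
          using x by blast
        moreover have "(0::real) < (1/2)^n"
          by simp
        ultimately obtain y where "y \<in> A (map s [0..<n])" "y \<in> X.mball x ((1/2)^n)"
          unfolding Xeq X.metric_closure_of by blast
        then show ?thesis
          by (auto simp: A_def)
      qed
      then obtain y p where yp: "\<And>n. (y n, p n) \<in> R" "\<And>n. p n \<in> B (map s [0..<n])"
        "\<And>n. dX x (y n) < (1/2)^n" and xM: "x \<in> MX"
        by metis
      have small: "\<exists>N. (1/2::real)^N < e" if "e > 0" for e
        using real_arch_pow_inv[of e "1/2"] that by auto
      have "P.MCauchy p"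
        unfolding P.MCauchy_def
      proof (intro conjI allI impI)
        show "range p \<subseteq> MP"
          using RM(2)[OF yp(1)] by blast
        fix e :: real
        assume "e > 0"
        then obtain N where N: "(1/2)^N < e / 2"
          using small[of "e/2"] by auto
        have near: "dP (c (s N)) (p n) < e / 2" if "n > N" for n
        proof -
          have "dP (c (s N)) (p n) < (1/2)^N"
            using yp(2)[of n] that by (auto simp: B_def)
          then show ?thesis
            using N by linarith
        qed
        have "dP (p n) (p n') < e" if "n > N" "n' > N" for n n'
          using P.triangle[OF RM(2)[OF yp(1)] cM RM(2)[OF yp(1)], of n n' "s N"] near[OF that(1)]
            near[OF that(2)] P.commute[of "p n" "c (s N)"] by linarith
        then show "\<exists>N. \<forall>n n'. N \<le> n \<longrightarrow> N \<le> n' \<longrightarrow> dP (p n) (p n') < e"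
          by (meson Suc_le_lessD)
      qed
      then obtain q where q: "limitin P p q sequentially"
        using \<open>P.mcomplete\<close> unfolding P.mcomplete_def Peq by blast
      have "limitin X y x sequentially"
        unfolding Xeq X.limit_metric_sequentially
      proof (intro conjI allI impI xM)
        fix e :: real
        assume "e > 0"
        then obtain N where N: "(1/2)^N < e"
          using small by blast
        have "y n \<in> MX \<and> dX (y n) x < e" if "n \<ge> N" for n
        proof -
          have "(1/2::real)^n \<le> (1/2)^N"
            using that by (intro power_decreasing) auto
          then have "dX (y n) x < e"
            using yp(3)[of n] N X.commute[of x "y n"] by linarith
          then show ?thesis
            using RM(1)[OF yp(1)] by blast
        qed
        then show "\<exists>N. \<forall>n\<ge>N. y n \<in> MX \<and> dX (y n) x < e"
          by blast
      qed
      with q have "limitin (prod_topology X P) (\<lambda>n. (y n, p n)) (x, q) sequentially"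
        by (simp add: limitin_pairwise o_def)
      then have "(x, q) \<in> R"
        by (rule limitin_closedin[OF _ R]) (auto simp: yp)
      then show "x \<in> A []"
        by (auto simp: A_def B_def)
    qed
  qed
  moreover have "A [] = fst ` R"
    by (auto simp: A_def B_def image_iff Bex_def)
  ultimately show ?thesis
    by simp
qed

abbreviation Baire_space :: "(nat \<Rightarrow> nat) topology" where
  "Baire_space \<equiv> product_topology (\<lambda>_. discrete_topology UNIV) UNIV"

text \<open>In a Polish space, these are the continuous images of Polish spaces. The definition as
  projections spares the construction of parametrizations.\<close>

definition analytic_in :: "'a topology \<Rightarrow> 'a set \<Rightarrow> bool" where
  "analytic_in X D \<longleftrightarrow> (\<exists>R. closedin (prod_topology X Baire_space) R \<and> D = fst ` R)"

lemma Polish_Baire_space: "Polish_space Baire_space"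
  by (intro Polish_space_product_topology Polish_space_discrete_nat) simp

lemma analytic_in_closedin:
  assumes "closedin X D"
  shows "analytic_in X D"
proof -
  have "closedin (prod_topology X Baire_space) (D \<times> topspace Baire_space)"
    unfolding closedin_prod_Times_iff using assms closedin_topspace by blast
  then show ?thesis
    unfolding analytic_in_def by (intro exI[of _ "D \<times> topspace Baire_space"]) simp
qed

lemma closedin_reindexed:
  fixes h :: "nat \<Rightarrow> nat"
  assumes "closedin (prod_topology X Baire_space) R"
  shows "closedin (prod_topology X Baire_space)
    {z \<in> topspace (prod_topology X Baire_space). (fst z, \<lambda>k. snd z (h k)) \<in> R}"
proof (rule closedin_continuous_map_preimage[OF _ assms])
  let ?T = "prod_topology X Baire_space"
  have "continuous_map ?T Baire_space (\<lambda>z k. snd z (h k))"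
    unfolding continuous_map_componentwise_UNIV
    by (intro allI continuous_map_compose[OF continuous_map_snd, unfolded o_def]
        continuous_map_product_coordinates) simp
  then show "continuous_map ?T ?T (\<lambda>z. (fst z, \<lambda>k. snd z (h k)))"
    by (simp add: continuous_map_pairwise o_def continuous_map_fst)
qed

text \<open>The first entry of a sequence chooses the member of the union, and the rest is the
  witness for it.\<close>

lemma analytic_in_UN:
  assumes "\<And>n::nat. analytic_in X (D n)"
  shows "analytic_in X (\<Union>n. D n)"
proof -
  let ?T = "prod_topology X Baire_space"
  obtain R where R: "\<And>n. closedin ?T (R n)" "\<And>n. D n = fst ` R n"
    using assms unfolding analytic_in_def by metis
  define S where "S = (\<Inter>n. {z \<in> topspace ?T. snd z 0 \<in> - {n}} \<union> {z \<in> topspace ?T. (fst z, \<lambda>k. snd z (Suc k)) \<in> R n})"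
  have "continuous_map ?T (discrete_topology UNIV) (\<lambda>z. snd z 0)"
    by (intro continuous_map_compose[OF continuous_map_snd, unfolded o_def]
        continuous_map_product_coordinates) auto
  then have "closedin ?T S"
    unfolding S_def by (intro closedin_INT closedin_Un closedin_reindexed R closedin_continuous_map_preimage) auto
  moreover have "(\<Union>n. D n) = fst ` S"
  proof (intro equalityI subsetI)
    fix x
    assume "x \<in> (\<Union>n. D n)"
    then obtain n s where ns: "(x, s) \<in> R n"
      using R(2) by auto
    then have "x \<in> topspace X"
      using closedin_subset[OF R(1)] by auto
    with ns have "(x, case_nat n s) \<in>
        {z \<in> topspace ?T. snd z 0 \<in> - {m}} \<union> {z \<in> topspace ?T. (fst z, \<lambda>k. snd z (Suc k)) \<in> R m}" for m
      by (cases "m = n") auto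
    then have "(x, case_nat n s) \<in> S"
      unfolding S_def by (rule INT_I)
    then show "x \<in> fst ` S"
      by (rule image_eqI[rotated]) simp
  next
    fix x
    assume "x \<in> fst ` S"
    then obtain s where "(x, s) \<in> S"
      by (metis imageE prod.collapse)
    then have "(x, s) \<in> {z \<in> topspace ?T. snd z 0 \<in> - {s 0}} \<union>
        {z \<in> topspace ?T. (fst z, \<lambda>k. snd z (Suc k)) \<in> R (s 0)}"
      unfolding S_def by (rule INT_D) simp
    then have "(x, \<lambda>k. s (Suc k)) \<in> R (s 0)"
      by simp
    then have "x \<in> D (s 0)"
      unfolding R(2) by (rule image_eqI[rotated]) simp
    then show "x \<in> (\<Union>n. D n)"
      by blast
  qed
  ultimately show ?thesis
    unfolding analytic_in_def by blast
qed

text \<open>One sequence codes a witness for each member of the intersection, by means of the pairing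
  function.\<close>

lemma analytic_in_INT:
  assumes "\<And>n::nat. analytic_in X (D n)"
  shows "analytic_in X (\<Inter>n. D n)"
proof -
  let ?T = "prod_topology X Baire_space"
  obtain R where R: "\<And>n. closedin ?T (R n)" "\<And>n. D n = fst ` R n"
    using assms unfolding analytic_in_def by metis
  define S where "S = (\<Inter>n. {z \<in> topspace ?T. (fst z, \<lambda>k. snd z (prod_encode (n, k))) \<in> R n})"
  have "closedin ?T S"
    unfolding S_def by (intro closedin_INT closedin_reindexed R) auto
  moreover have "(\<Inter>n. D n) = fst ` S"
  proof (intro equalityI subsetI)
    fix x
    assume "x \<in> (\<Inter>n. D n)"
    then have "x \<in> fst ` R n" for n
      using R(2) by blast
    then have "\<exists>s. (x, s) \<in> R n" for n
      by (metis imageE prod.collapse)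
    then obtain s where s: "\<And>n. (x, s n) \<in> R n"
      by metis
    then have "x \<in> topspace X"
      using subsetD[OF closedin_subset[OF R(1)] s] by simp
    with s have "(x, \<lambda>j. case prod_decode j of (n, k) \<Rightarrow> s n k) \<in> S"
      by (auto simp: S_def)
    then show "x \<in> fst ` S"
      by (rule image_eqI[rotated]) simp
  next
    fix x
    assume "x \<in> fst ` S"
    then obtain s where "(x, s) \<in> S"
      by (metis imageE prod.collapse)
    then have "(x, \<lambda>k. s (prod_encode (n, k))) \<in> R n" for n
      by (simp add: S_def)
    then show "x \<in> (\<Inter>n. D n)"
      unfolding R(2) by (metis INT_I fst_conv imageI)
  qed
  ultimately show ?thesis
    unfolding analytic_in_def by blast
qed

text \<open>The analytic sets with analytic complement form a \<open>\<sigma>\<close>-algebra. It contains the open sets,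
  because these are countable unions of closed sets in a metrizable space.\<close>

lemma analytic_in_borel:
  assumes X: "metrizable_space X" and D: "D \<in> sets (borel_of X)"
  shows "analytic_in X D"
proof -
  have "analytic_in X D \<and> analytic_in X (topspace X - D)"
    using D unfolding sets_borel_of
  proof induction
    case (Basic U)
    then have U: "openin X U"
      by simp
    obtain F where "\<And>n::nat. closedin X (F n)" "U = (\<Union>n. F n)"
      using open_imp_fsigma_in[OF X U] unfolding fsigma_in_ascending by metis
    then have "analytic_in X U"
      by (auto intro: analytic_in_UN analytic_in_closedin)
    moreover have "closedin X (topspace X - U)"
      using U by blast
    ultimately show ?case
      by (simp add: analytic_in_closedin)
  next
    case Empty
    then show ?case
      by (auto intro!: analytic_in_closedin)
  next
    case (Compl D)
    then have "D \<subseteq> topspace X"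
      using sets.sets_into_space[of D "borel_of X"] by (simp add: sets_borel_of)
    then have "topspace X - (topspace X - D) = D"
      by blast
    then show ?case
      using Compl.IH by simp
  next
    case (Union D)
    have "topspace X - (\<Union>n. D n) = (\<Inter>n. topspace X - D n)"
      by auto
    moreover have "analytic_in X (\<Inter>n. topspace X - D n)"
      using Union by (intro analytic_in_INT) blast
    moreover have "analytic_in X (\<Union>n. D n)"
      using Union by (intro analytic_in_UN) blast
    ultimately show ?case
      by simp
  qed
  then show ?thesis ..
qed

text \<open>Agreement from coordinate \<open>n\<close> on is a closed relation, so intersecting it with a closed set that
  represents \<open>B\<close> as an analytic set leaves a closed set of triples: a point, an equivalent point of
  \<open>B\<close>, and a witness for that one.\<close>

lemma eventual_agreement_universally_measurable:
  fixes X :: "nat \<Rightarrow> 'a topology"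
  assumes P: "\<And>i. Polish_space (X i)"
    and B: "B \<in> sets (borel_of (product_topology X UNIV))"
  shows "{x \<in> topspace (product_topology X UNIV). \<exists>n. \<exists>z\<in>B. \<forall>i\<ge>n. z i = x i}
    \<in> sets (universal_algebra (product_topology X UNIV))"
proof (cases "\<forall>i. topspace (X i) \<noteq> {}")
  case False
  then have "topspace (product_topology X UNIV) = {}"
    by (auto simp: PiE_eq_empty_iff)
  then show ?thesis
    by simp
next
  case True
  let ?T = "product_topology X UNIV"
  let ?TP = "prod_topology ?T (prod_topology ?T Baire_space)"
  have T: "Polish_space ?T"
    using True by (intro Polish_space_product_topology P) auto
  have "analytic_in ?T B"
    using B T by (intro analytic_in_borel Polish_space_metrizable)
  then obtain R where R: "closedin (prod_topology ?T Baire_space) R" "B = fst ` R"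
    unfolding analytic_in_def by blast
  define Q where "Q n = {w \<in> topspace ?TP. snd w \<in> R} \<inter>
      (\<Inter>i\<in>{n..}. {w \<in> topspace ?TP. fst (snd w) i = fst w i})" for n
  have Q: "closedin ?TP (Q n)" for n
  proof -
    have "closedin ?TP {w \<in> topspace ?TP. fst (snd w) i = fst w i}" for i
    proof (rule closedin_continuous_maps_eq)
      show "Hausdorff_space (X i)"
        using P by (intro metrizable_imp_Hausdorff_space Polish_space_metrizable)
      show "continuous_map ?TP (X i) (\<lambda>w. fst (snd w) i)"
        by (intro continuous_map_compose[OF continuous_map_snd, unfolded o_def]
            continuous_map_compose[OF continuous_map_fst, unfolded o_def]
            continuous_map_product_coordinates) auto
      show "continuous_map ?TP (X i) (\<lambda>w. fst w i)"
        by (intro continuous_map_compose[OF continuous_map_fst, unfolded o_def]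
            continuous_map_product_coordinates) auto
    qed
    then show ?thesis
      unfolding Q_def
      by (intro closedin_Int closedin_INT closedin_continuous_map_preimage[OF continuous_map_snd R(1)]) auto
  qed
  have eq: "{x \<in> topspace ?T. \<exists>n. \<exists>z\<in>B. \<forall>i\<ge>n. z i = x i} = (\<Union>n. fst ` Q n)"
  proof (intro equalityI subsetI)
    fix x
    assume "x \<in> {x \<in> topspace ?T. \<exists>n. \<exists>z\<in>B. \<forall>i\<ge>n. z i = x i}"
    then obtain n z where x: "x \<in> topspace ?T" and "z \<in> B" and agree: "\<forall>i\<ge>n. z i = x i"
      by blast
    then obtain s where z: "(z, s) \<in> R"
      using R(2) by auto
    have "z \<in> topspace ?T"
      using z closedin_subset[OF R(1)] by auto
    then have "(x, (z, s)) \<in> Q n"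
      using x z agree by (auto simp: Q_def)
    then show "x \<in> (\<Union>n. fst ` Q n)"
      by (metis UN_I UNIV_I fst_conv imageI)
  next
    fix x
    assume "x \<in> (\<Union>n. fst ` Q n)"
    then obtain n z s where "(x, (z, s)) \<in> Q n"
      by auto
    then have "x \<in> topspace ?T" "(z, s) \<in> R" "\<forall>i\<ge>n. z i = x i"
      by (auto simp: Q_def)
    moreover have "z \<in> B"
      using R(2) \<open>(z, s) \<in> R\<close> by force
    ultimately show "x \<in> {x \<in> topspace ?T. \<exists>n. \<exists>z\<in>B. \<forall>i\<ge>n. z i = x i}"
      by blast
  qed
  have "fst ` Q n \<in> sets (completion \<mu>)" if "borel_prob ?T \<mu>" for \<mu> n
    by (rule projection_closedin_in_completion[OF Polish_space_metrizable[OF T]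
          Polish_space_prod_topology[OF T Polish_Baire_space] Q that])
  then have "(\<Union>n. fst ` Q n) \<in> sets (completion \<mu>)" if "borel_prob ?T \<mu>" for \<mu>
    using that by (intro sets.countable_UN) auto
  moreover have "(\<Union>n. fst ` Q n) \<subseteq> topspace ?T"
    unfolding eq[symmetric] by blast
  ultimately show ?thesis
    unfolding sets_universal_algebra eq by blast
qed

section \<open>A zero-one law for tail sets that need not be measurable\<close>

definition graft :: "nat \<Rightarrow> (nat \<Rightarrow> 'a) \<Rightarrow> (nat \<Rightarrow> 'a) \<Rightarrow> nat \<Rightarrow> 'a" where
  "graft n y x = (\<lambda>i. if i < n then y i else x i)"

lemma graft_in_space:
  "y \<in> space (PiM UNIV M) \<Longrightarrow> x \<in> space (PiM UNIV M) \<Longrightarrow> graft n y x \<in> space (PiM UNIV M)"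
  by (auto simp: space_PiM PiE_iff graft_def)

text \<open>In the argument \<open>x\<close> only the coordinates from \<open>n\<close> on need to be measurable. This is what makes the
  sets \<open>G n\<close> in the proof of \<open>subset_tail_null\<close> events of the tail.\<close>

lemma measurable_graft:
  assumes "\<And>i. i \<ge> n \<Longrightarrow> (\<lambda>x. x i) \<in> N \<rightarrow>\<^sub>M M i"
  shows "(\<lambda>(x, y). graft n y x) \<in> N \<Otimes>\<^sub>M PiM UNIV M \<rightarrow>\<^sub>M PiM UNIV M"
proof (rule measurable_PiM_single')
  fix i :: nat
  show "(\<lambda>z. (case z of (x, y) \<Rightarrow> graft n y x) i) \<in> N \<Otimes>\<^sub>M PiM UNIV M \<rightarrow>\<^sub>M M i"
  proof (cases "i < n")
    case True
    then show ?thesis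
      by (simp add: graft_def split_beta)
  next
    case False
    then have "(\<lambda>z. fst z i) \<in> N \<Otimes>\<^sub>M PiM UNIV M \<rightarrow>\<^sub>M M i"
      by (intro measurable_compose[OF measurable_fst assms]) auto
    with False show ?thesis
      by (simp add: graft_def split_beta)
  qed
next
  show "(\<lambda>z i. (case z of (x, y) \<Rightarrow> graft n y x) i) \<in>
      space (N \<Otimes>\<^sub>M PiM UNIV M) \<rightarrow> (\<Pi>\<^sub>E i\<in>UNIV. space (M i))"
    using measurable_space[OF assms]
    by (auto simp: space_pair_measure space_PiM PiE_iff graft_def split_beta)
qed

lemma distr_graft:
  fixes M :: "nat \<Rightarrow> 'a measure"
  assumes "\<And>i. prob_space (M i)"
  shows "distr (PiM UNIV M \<Otimes>\<^sub>M PiM UNIV M) (PiM UNIV M) (\<lambda>(x, y). graft n y x) = PiM UNIV M"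
    (is "distr ?PP ?P ?g = _")
proof -
  interpret prob_space "M i" for i by fact
  interpret product_prob_space M UNIV ..
  have g: "?g \<in> ?PP \<rightarrow>\<^sub>M ?P"
    by (rule measurable_graft) simp
  show ?thesis
  proof (rule PiM_eq)
    fix J :: "nat set" and F :: "nat \<Rightarrow> 'a set"
    assume J: "finite J" and F: "\<And>j. j \<in> J \<Longrightarrow> F j \<in> sets (M j)"
    let ?A = "{x \<in> space ?P. \<forall>j\<in>J \<inter> {n..}. x j \<in> F j}"
    let ?B = "{y \<in> space ?P. \<forall>j\<in>J \<inter> {..<n}. y j \<in> F j}"
    have A: "?A \<in> sets ?P"
      using J F by (intro sets.sets_Collect_finite_All) auto
    have B: "?B \<in> sets ?P"
      using J F by (intro sets.sets_Collect_finite_All) auto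
    have "?g -` prod_emb UNIV M J (Pi\<^sub>E J F) \<inter> space ?PP = ?A \<times> ?B"
      by (auto simp: prod_emb_def space_pair_measure space_PiM graft_def PiE_iff split: if_split_asm)
    then have "emeasure (distr ?PP ?P ?g) (prod_emb UNIV M J (Pi\<^sub>E J F)) = emeasure ?PP (?A \<times> ?B)"
      using J F by (simp add: emeasure_distr[OF g] sets_PiM_I)
    also have "\<dots> = emeasure ?P ?A * emeasure ?P ?B"
      using A B by (rule P.emeasure_pair_measure_Times)
    also have "\<dots> = (\<Prod>j\<in>J \<inter> {n..}. emeasure (M j) (F j)) * (\<Prod>j\<in>J \<inter> {..<n}. emeasure (M j) (F j))"
      using J F by (subst (1 2) emeasure_PiM_Collect) auto
    also have "\<dots> = (\<Prod>j\<in>J. emeasure (M j) (F j))"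
      using J by (subst prod.union_disjoint[symmetric]) (auto intro!: prod.cong)
    finally show "emeasure (distr ?PP ?P ?g) (prod_emb UNIV M J (Pi\<^sub>E J F)) =
        (\<Prod>j\<in>J. emeasure (M j) (F j))" .
  qed simp
qed

lemma indep_vars_PiM_coordinates:
  fixes M :: "nat \<Rightarrow> 'a measure"
  assumes "\<And>i. prob_space (M i)"
  shows "prob_space.indep_vars (PiM UNIV M) M (\<lambda>i x. x i) UNIV"
proof -
  interpret prob_space "M i" for i by fact
  interpret product_prob_space M UNIV ..
  have "distr (PiM UNIV M) (PiM UNIV M) (\<lambda>x. \<lambda>i\<in>UNIV. x i) = PiM UNIV M"
    by (simp add: restrict_UNIV distr_id)
  also have "\<dots> = PiM UNIV (\<lambda>i. distr (PiM UNIV M) (M i) (\<lambda>x. x i))"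
    by (intro PiM_cong refl PiM_component[symmetric]) auto
  finally show ?thesis
    by (subst P.indep_vars_iff_distr_eq_PiM) auto
qed

text \<open>Let \<open>g n x\<close> be the conditional probability of \<open>B\<close> given the coordinates of \<open>x\<close> from \<open>n\<close> on. A
  point whose whole tail class lies in \<open>B\<close> satisfies \<open>g n x = 1\<close> for all \<open>n\<close>, so it belongs to the limit
  superior \<open>L\<close> of the sets \<open>G n\<close> where \<open>g n\<close> is \<open>1\<close>. Now \<open>L\<close> is a tail event, to which
  Kolmogorov's law applies, and its probability is at most that of \<open>B\<close>, because each \<open>G n\<close> is
  contained in \<open>B\<close> up to a null set.\<close>

lemma subset_tail_null:
  fixes M :: "nat \<Rightarrow> 'a measure"
  assumes M: "\<And>i. prob_space (M i)"
    and B: "B \<in> sets (PiM UNIV M)" and lt: "emeasure (PiM UNIV M) B < 1"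
  shows "\<exists>N\<in>null_sets (PiM UNIV M).
    {x \<in> space (PiM UNIV M). \<forall>n. \<forall>y\<in>space (PiM UNIV M). graft n y x \<in> B} \<subseteq> N"
proof -
  let ?P = "PiM UNIV M"
  interpret prob_space "M i" for i by fact
  interpret product_prob_space M UNIV ..
  define g where "g n x = emeasure ?P {y \<in> space ?P. graft n y x \<in> B}" for n x
  define G where "G n = {x \<in> space ?P. g n x = 1}" for n
  define F where "F i = sigma_sets (space ?P) {(\<lambda>x. x i) -` A \<inter> space ?P | A. A \<in> sets (M i)}" for i
  have indep: "P.indep_sets F UNIV"
    using indep_vars_PiM_coordinates[of M, OF M] unfolding P.indep_vars_def F_def by simp
  have F_sub: "F i \<subseteq> Pow (space ?P)" for i
    unfolding F_def by (rule subsetI, rule PowI, erule sigma_sets_into_sp[rotated]) auto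
  have F_alg: "sigma_algebra (space ?P) (F i)" for i
    unfolding F_def by (rule sigma_algebra_sigma_sets) auto
  have G_tail: "G n \<in> sigma_sets (space ?P) (\<Union>(F ` {m..}))" if mn: "m \<le> n" for n m
  proof -
    \<comment> \<open>The product space, equipped with the \<open>\<sigma>\<close>-algebra of the coordinates from \<open>m\<close> on only.\<close>
    let ?N = "sigma (space ?P) (\<Union>(F ` {m..}))"
    have sp: "space ?N = space ?P"
      by (simp add: space_measure_of_conv)
    have sN: "sets ?N = sigma_sets (space ?P) (\<Union>(F ` {m..}))"
      using F_sub by (intro sets_measure_of) auto
    have "(\<lambda>x. x i) \<in> ?N \<rightarrow>\<^sub>M M i" if "i \<ge> n" for i
    proof (rule measurableI)
      show "x i \<in> space (M i)" if "x \<in> space ?N" for x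
        using that unfolding sp by (auto simp: space_PiM PiE_iff)
      fix A
      assume "A \<in> sets (M i)"
      then have "(\<lambda>x. x i) -` A \<inter> space ?P \<in> F i"
        unfolding F_def by (intro sigma_sets.Basic) auto
      then show "(\<lambda>x. x i) -` A \<inter> space ?N \<in> sets ?N"
        unfolding sp sN using \<open>i \<ge> n\<close> mn by (intro sigma_sets.Basic) auto
    qed
    then have gr: "(\<lambda>(x, y). graft n y x) \<in> ?N \<Otimes>\<^sub>M ?P \<rightarrow>\<^sub>M ?P"
      by (rule measurable_graft)
    let ?Q = "(\<lambda>(x, y). graft n y x) -` B \<inter> space (?N \<Otimes>\<^sub>M ?P)"
    have "?Q \<in> sets (?N \<Otimes>\<^sub>M ?P)"
      using gr B by (rule measurable_sets)
    then have "(\<lambda>x. emeasure ?P (Pair x -` ?Q)) \<in> borel_measurable ?N"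
      by (rule P.measurable_emeasure_Pair)
    then have "{x \<in> space ?N. emeasure ?P (Pair x -` ?Q) = 1} \<in> sets ?N"
      by measurable
    also have "{x \<in> space ?N. emeasure ?P (Pair x -` ?Q) = 1} = G n"
      unfolding G_def g_def sp by (intro Collect_cong conj_cong refl arg_cong2[where f="(=)"]
          arg_cong2[where f=emeasure]) (auto simp: space_pair_measure sp)
    finally show ?thesis
      unfolding sN .
  qed
  have G_sets [measurable]: "G n \<in> sets ?P" for n
  proof -
    have "\<Union>(F ` {0..}) \<subseteq> sets ?P"
      using indep unfolding P.indep_sets_def by blast
    then show ?thesis
      using G_tail[of 0 n] sets.sigma_sets_subset by blast
  qed
  have GB: "G n - B \<in> null_sets ?P" for n
  proof (rule null_setsI)
    have gr: "(\<lambda>(x, y). graft n y x) \<in> ?P \<Otimes>\<^sub>M ?P \<rightarrow>\<^sub>M ?P"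
      by (rule measurable_graft) simp
    show GBs: "G n - B \<in> sets ?P"
      using B by auto
    let ?Q = "(\<lambda>(x, y). graft n y x) -` (G n - B) \<inter> space (?P \<Otimes>\<^sub>M ?P)"
    have Q: "?Q \<in> sets (?P \<Otimes>\<^sub>M ?P)"
      using gr GBs by (rule measurable_sets)
    \<comment> \<open>As \<open>G n\<close> depends on the coordinates from \<open>n\<close> on only, resampling the others does not change
      membership in it, while on \<open>G n\<close> the resampled point is almost surely in \<open>B\<close>.\<close>
    have inv: "g n (graft n y x) = g n x" for x y
      by (simp add: g_def graft_def cong: if_cong)
    have "emeasure ?P (Pair x -` ?Q) = 0" if x: "x \<in> space ?P" for x
    proof (cases "g n x = 1")
      case True
      have Bx: "{y \<in> space ?P. graft n y x \<in> B} \<in> sets ?P"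
      proof -
        have "Pair x -` ((\<lambda>(x, y). graft n y x) -` B \<inter> space (?P \<Otimes>\<^sub>M ?P)) \<in> sets ?P"
          by (rule sets_Pair1[OF measurable_sets[OF gr B]])
        also have "Pair x -` ((\<lambda>(x, y). graft n y x) -` B \<inter> space (?P \<Otimes>\<^sub>M ?P)) =
            {y \<in> space ?P. graft n y x \<in> B}"
          using x by (auto simp: space_pair_measure)
        finally show ?thesis .
      qed
      have sub: "Pair x -` ?Q \<subseteq> space ?P - {y \<in> space ?P. graft n y x \<in> B}"
        by (auto simp: space_pair_measure)
      have zero: "emeasure ?P (space ?P - {y \<in> space ?P. graft n y x \<in> B}) = 0"
        using emeasure_compl[OF Bx] True by (simp add: g_def P.emeasure_space_1)
      show ?thesis
        by (rule emeasure_eq_0[OF sets.compl_sets[OF Bx] zero sub])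
    next
      case False
      then have "Pair x -` ?Q = {}"
        by (auto simp: G_def inv)
      then show ?thesis
        by simp
    qed
    then have "emeasure (?P \<Otimes>\<^sub>M ?P) ?Q = 0"
      unfolding P.emeasure_pair_measure_alt[OF Q] by (simp cong: nn_integral_cong)
    then show "emeasure ?P (G n - B) = 0"
      using emeasure_distr[OF gr GBs] distr_graft[of M, OF M] by simp
  qed
  define L where "L = (\<Inter>m. \<Union>n\<in>{m..}. G n)"
  have "L \<in> P.tail_events F"
    unfolding P.tail_events_def
  proof
    fix k
    interpret S: sigma_algebra "space ?P" "sigma_sets (space ?P) (\<Union>(F ` {k..}))"
      using F_sub by (intro sigma_algebra_sigma_sets) auto
    have "L = (\<Inter>m\<in>{k..}. \<Union>n\<in>{m..}. G n)"
      unfolding L_def by (intro decseq_SucI INT_decseq_offset UN_mono) auto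
    also have "\<dots> \<in> sigma_sets (space ?P) (\<Union>(F ` {k..}))"
    proof (rule S.countable_INT')
      have "(\<Union>n\<in>{m..}. G n) \<in> sigma_sets (space ?P) (\<Union>(F ` {k..}))" if "m \<ge> k" for m
        using that by (intro S.countable_UN'' G_tail) auto
      then show "(\<lambda>m. \<Union>n\<in>{m..}. G n) ` {k..} \<subseteq> sigma_sets (space ?P) (\<Union>(F ` {k..}))"
        by auto
    qed auto
    finally show "L \<in> sigma_sets (space ?P) (\<Union>(F ` {k..}))" .
  qed
  then have "P.prob L = 0 \<or> P.prob L = 1"
    by (rule P.kolmogorov_0_1_law[OF F_alg indep])
  moreover have Ls: "L \<in> sets ?P"
    unfolding L_def by measurable
  moreover have "emeasure ?P L < 1"
  proof -
    have N: "(\<Union>n. G n - B) \<in> null_sets ?P"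
      using GB by (intro null_sets_UN)
    have "emeasure ?P L \<le> emeasure ?P (B \<union> (\<Union>n. G n - B))"
      using B by (intro emeasure_mono) (auto simp: L_def)
    also have "\<dots> = emeasure ?P B"
      using B N by (rule emeasure_Un_null_set)
    finally show ?thesis
      using lt by simp
  qed
  ultimately have "L \<in> null_sets ?P"
    by (auto simp: P.emeasure_eq_measure intro: null_setsI)
  moreover have "{x \<in> space ?P. \<forall>n. \<forall>y\<in>space ?P. graft n y x \<in> B} \<subseteq> L"
  proof
    fix x
    assume x: "x \<in> {x \<in> space ?P. \<forall>n. \<forall>y\<in>space ?P. graft n y x \<in> B}"
    then have "{y \<in> space ?P. graft n y x \<in> B} = space ?P" for n
      by auto
    then have "x \<in> G n" for n
      using x by (simp add: G_def g_def P.emeasure_space_1)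
    then show "x \<in> L"
      by (auto simp: L_def)
  qed
  ultimately show ?thesis
    by blast
qed

section \<open>Attaining the expectation by mixing two points in one coordinate\<close>

lemma PiM_return_except_one:
  fixes M :: "nat \<Rightarrow> 'a measure"
  assumes \<nu>: "prob_space \<nu>" "sets \<nu> = sets (M k)" and w: "w \<in> space (PiM UNIV M)"
  shows "PiM UNIV (\<lambda>i. if i = k then \<nu> else return (M i) (w i)) =
    distr \<nu> (PiM UNIV M) (\<lambda>v. w(k := v))" (is "PiM UNIV ?\<tau> = distr \<nu> ?P ?h")
proof -
  have wM: "w i \<in> space (M i)" for i
    using w by (auto simp: space_PiM PiE_iff)
  interpret prob_space \<nu> by fact
  interpret T: prob_space "?\<tau> i" for i
    using \<nu>(1) wM by (auto intro: prob_space_return)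
  interpret T: product_prob_space ?\<tau> UNIV ..
  have sets_\<tau>: "sets (?\<tau> i) = sets (M i)" for i
    using \<nu>(2) by simp
  have sets_P: "sets ?P = sets (PiM UNIV ?\<tau>)"
    using sets_\<tau> by (intro sets_PiM_cong) auto
  have sp: "space (?\<tau> i) = space (M i)" for i
    by (rule sets_eq_imp_space_eq[OF sets_\<tau>])
  have spk: "space \<nu> = space (M k)"
    by (rule sets_eq_imp_space_eq[OF \<nu>(2)])
  have h: "?h \<in> \<nu> \<rightarrow>\<^sub>M ?P"
  proof (rule measurable_PiM_single')
    show "(\<lambda>v. (w(k := v)) i) \<in> \<nu> \<rightarrow>\<^sub>M M i" for i
      using \<nu>(2) wM by (cases "i = k") (auto intro: measurable_ident_sets)
    show "(\<lambda>v. w(k := v)) \<in> space \<nu> \<rightarrow> (\<Pi>\<^sub>E i\<in>UNIV. space (M i))"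
      using wM by (auto simp: spk PiE_iff)
  qed
  show ?thesis
  proof (rule T.PiM_eq[symmetric])
    show "sets (distr \<nu> ?P ?h) = sets (PiM UNIV ?\<tau>)"
      using sets_P by simp
    fix J :: "nat set" and F :: "nat \<Rightarrow> 'a set"
    assume J: "finite J" and "\<And>j. j \<in> J \<Longrightarrow> F j \<in> sets (?\<tau> j)"
    then have F: "F j \<in> sets (M j)" if "j \<in> J" for j
      using sets_\<tau> that by blast
    let ?E = "prod_emb UNIV ?\<tau> J (Pi\<^sub>E J F)"
    have "?E \<in> sets ?P"
      unfolding sets_P using J F sets_\<tau> by (intro sets_PiM_I) auto
    then have "emeasure (distr \<nu> ?P ?h) ?E = emeasure \<nu> (?h -` ?E \<inter> space \<nu>)"
      by (rule emeasure_distr[OF h])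
    also have "?h -` ?E \<inter> space \<nu> = {v \<in> space \<nu>. \<forall>j\<in>J. (w(k := v)) j \<in> F j}"
      using wM by (auto simp: prod_emb_def sp spk PiE_iff split: if_split_asm)
    also have "emeasure \<nu> \<dots> = (\<Prod>j\<in>J. emeasure (?\<tau> j) (F j))"
    \<comment> \<open>The factors with \<open>j \<noteq> k\<close> are all \<open>0\<close> or \<open>1\<close>; if one of them is \<open>0\<close>, both sides vanish.\<close>
    proof (cases "\<forall>j\<in>J - {k}. w j \<in> F j")
      case True
      then have "(\<Prod>j\<in>J - {k}. emeasure (?\<tau> j) (F j)) = 1"
        using F by (intro prod.neutral) auto
      then have "(\<Prod>j\<in>J. emeasure (?\<tau> j) (F j)) = (if k \<in> J then emeasure \<nu> (F k) else 1)"
        using prod.remove[OF J, of k "\<lambda>j. emeasure (?\<tau> j) (F j)"] by (cases "k \<in> J") auto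
      moreover have "{v \<in> space \<nu>. \<forall>j\<in>J. (w(k := v)) j \<in> F j} = (if k \<in> J then F k else space \<nu>)"
        using True F[of k] sets.sets_into_space[of "F k" \<nu>] \<nu>(2) by auto
      ultimately show ?thesis
        by (simp add: emeasure_space_1)
    next
      case False
      then obtain j where j: "j \<in> J" "j \<noteq> k" "w j \<notin> F j"
        by blast
      then have "emeasure (?\<tau> j) (F j) = 0"
        using F by simp
      then have "(\<Prod>j\<in>J. emeasure (?\<tau> j) (F j)) = 0"
        using j(1) by (intro prod_zero[OF J] bexI[of _ j])
      moreover have "{v \<in> space \<nu>. \<forall>j\<in>J. (w(k := v)) j \<in> F j} = {}"
        using j by auto
      ultimately show ?thesis
        by (simp only: emeasure_empty)
    qed
    finally show "emeasure (distr \<nu> ?P ?h) ?E = (\<Prod>j\<in>J. emeasure (?\<tau> j) (F j))" .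
  qed
qed

lemma ex_crossing_step:
  fixes a :: "nat \<Rightarrow> real"
  assumes "a 0 \<le> c" "c \<le> a n" "n > 0"
  shows "\<exists>k<n. a k \<le> c \<and> c \<le> a (Suc k)"
proof -
  define k where "k = (LEAST k. c \<le> a (Suc k))"
  have "c \<le> a (Suc (n - 1))"
    using assms by simp
  then have "c \<le> a (Suc k)" "k \<le> n - 1"
    unfolding k_def by (rule LeastI, rule Least_le)
  moreover have "a k \<le> c"
  proof (cases k)
    case (Suc j)
    then have "\<not> c \<le> a (Suc j)"
      using not_less_Least[of j "\<lambda>k. c \<le> a (Suc k)"] by (simp add: k_def)
    with Suc show ?thesis
      by simp
  qed (use assms in simp)
  ultimately show ?thesis
    using \<open>n > 0\<close> by (intro exI[of _ k]) auto
qed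

text \<open>The points \<open>graft k z y\<close> lead from \<open>y\<close> to \<open>z\<close> by changing one coordinate at a time. At a step
  where \<open>f\<close> crosses its mean, the two values of the changed coordinate are taken with
  probabilities that average \<open>f\<close> to exactly this mean.\<close>

lemma weak_approx_of_crossing:
  fixes X :: "nat \<Rightarrow> 'a topology"
  assumes f: "f \<in> borel_measurable (\<Pi>\<^sub>M i\<in>UNIV. borel_of (X i))"
    and x: "x \<in> topspace (product_topology X UNIV)"
    and y: "y \<in> topspace (product_topology X UNIV)" "\<And>i. i \<ge> m \<Longrightarrow> y i = x i" "f y \<le> (\<integral>z. f z \<partial>\<mu>)"
    and z: "z \<in> topspace (product_topology X UNIV)" "\<And>i. i \<ge> n \<Longrightarrow> z i = x i" "(\<integral>z. f z \<partial>\<mu>) \<le> f z"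
  shows "x \<in> weak_approx X 0 \<mu> f"
proof -
  let ?M = "\<lambda>i. borel_of (X i)"
  define c where "c = (\<integral>z. f z \<partial>\<mu>)"
  \<comment> \<open>The successor makes \<open>l\<close> positive, so that there is at least one step even if \<open>y = z\<close>.\<close>
  define l where "l = Suc (max m n)"
  have "graft l z y = z"
    using y(2) z(2) by (auto simp: graft_def l_def)
  then have "\<exists>k<l. f (graft k z y) \<le> c \<and> c \<le> f (graft (Suc k) z y)"
    using y(3) z(3) by (intro ex_crossing_step) (auto simp: c_def graft_def l_def)
  then obtain k where k: "k < l" "f (graft k z y) \<le> c" "c \<le> f (graft (Suc k) z y)"
    by blast
  define w where "w = graft k z y"
  have w_upd: "w(k := z k) = graft (Suc k) z y" "w(k := y k) = w"
    by (auto simp: w_def graft_def less_Suc_eq)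
  have w: "w \<in> space (PiM UNIV ?M)"
    using y(1) z(1) by (auto simp: w_def graft_def space_PiM PiE_iff)
  have wx: "w i = x i" if "i \<ge> l" for i
    using that y(2)[of i] z(2)[of i] by (auto simp: w_def graft_def l_def)
  have wX: "w i \<in> topspace (X i)" "y i \<in> topspace (X i)" "z i \<in> topspace (X i)" for i
    using w y(1) z(1) by (auto simp: space_PiM PiE_iff)
  obtain t where t: "0 \<le> t" "t \<le> 1" "f (graft (Suc k) z y) * t + f w * (1 - t) = c"
  proof (cases "f w = f (graft (Suc k) z y)")
    case True
    with k show ?thesis
      by (intro that[of 0]) (auto simp: w_def)
  next
    case False
    have affine: "p * u + q * (1 - u) = q + (p - q) * u" for p q u :: real
      by (simp add: algebra_simps)
    let ?d = "f (graft (Suc k) z y) - f w"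
    have d: "?d > 0"
      using k False by (simp add: w_def)
    have "f (graft (Suc k) z y) * ((c - f w) / ?d) + f w * (1 - (c - f w) / ?d)
        = f w + ?d * ((c - f w) / ?d)"
      by (rule affine)
    also have "\<dots> = c"
      using d by simp
    finally show ?thesis
      using d k by (intro that[of "(c - f w) / ?d"]) (auto simp: w_def)
  qed
  let ?b = "\<lambda>b. if b then z k else y k"
  define \<nu> where "\<nu> = distr (bernoulli_pmf t) (?M k) ?b"
  have b: "?b \<in> measure_pmf (bernoulli_pmf t) \<rightarrow>\<^sub>M ?M k"
    using wX by (auto simp: measurable_def)
  have \<nu>: "prob_space \<nu>" "sets \<nu> = sets (?M k)"
    unfolding \<nu>_def by (auto intro!: measure_pmf.prob_space_distr b)
  let ?\<tau> = "\<lambda>i. if i = k then \<nu> else return (?M i) (w i)"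
  have upd: "(\<lambda>v. w(k := v)) \<in> \<nu> \<rightarrow>\<^sub>M PiM UNIV ?M"
  proof (rule measurable_PiM_single')
    show "(\<lambda>v. (w(k := v)) i) \<in> \<nu> \<rightarrow>\<^sub>M ?M i" for i
      using \<nu>(2) wX by (cases "i = k") (auto intro: measurable_ident_sets)
    show "(\<lambda>v. w(k := v)) \<in> space \<nu> \<rightarrow> (\<Pi>\<^sub>E i\<in>UNIV. space (?M i))"
      using wX by (auto simp: \<nu>_def PiE_iff)
  qed
  have "(\<integral>u. f u \<partial>PiM UNIV ?\<tau>) = (\<integral>u. f u \<partial>distr \<nu> (PiM UNIV ?M) (\<lambda>v. w(k := v)))"
    using PiM_return_except_one[of \<nu> ?M k w] \<nu> w by simp
  also have "\<dots> = (\<integral>v. f (w(k := v)) \<partial>\<nu>)"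
    by (rule integral_distr[OF upd f])
  also have "\<dots> = (\<integral>b. f (w(k := ?b b)) \<partial>bernoulli_pmf t)"
    unfolding \<nu>_def
  proof (rule integral_distr[OF b])
    show "(\<lambda>v. f (w(k := v))) \<in> borel_measurable (?M k)"
      using measurable_compose[OF upd f] \<nu>(2) by (simp cong: measurable_cong_sets)
  qed
  also have "\<dots> = c"
    using t by (simp add: w_upd)
  finally have c: "(\<integral>u. f u \<partial>PiM UNIV ?\<tau>) = c" .
  have "PiM UNIV (\<lambda>i. if i < l then ?\<tau> i else return (?M i) (x i)) = PiM UNIV ?\<tau>"
    using k(1) wx by (intro PiM_cong) auto
  with c have "\<bar>(\<integral>u. f u \<partial>PiM UNIV (\<lambda>i. if i < l then ?\<tau> i else return (?M i) (x i))) - (\<integral>z. f z \<partial>\<mu>)\<bar> \<le> 0"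
    by (simp add: c_def)
  moreover have "\<forall>i<l. borel_prob (X i) (?\<tau> i)"
    using \<nu> wX by (auto simp: borel_prob_def intro: prob_space_return)
  ultimately show ?thesis
    unfolding weak_approx_def by (intro CollectI conjI x exI[of _ l] exI[of _ ?\<tau>])
qed

section \<open>The set of weak approximations\<close>

text \<open>A product measure that is Dirac at \<open>x\<close> from some coordinate on is concentrated on points
  equivalent to \<open>x\<close>. If \<open>f\<close> exceeded its mean under \<open>\<mu>\<close> at all of these, its mean under
  the product measure would be strictly larger.\<close>

lemma weak_approx_lower_point:
  fixes X :: "nat \<Rightarrow> 'a topology"
  assumes P: "\<And>i. Polish_space (X i)"
    and f: "f \<in> borel_measurable (\<Pi>\<^sub>M i\<in>UNIV. borel_of (X i))"
    and bdd: "bounded (f ` topspace (product_topology X UNIV))"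
    and x: "x \<in> weak_approx X 0 \<mu> f"
  shows "\<exists>n. \<exists>z\<in>topspace (product_topology X UNIV). f z \<le> (\<integral>y. f y \<partial>\<mu>) \<and> (\<forall>i\<ge>n. z i = x i)"
proof (rule ccontr)
  assume no: "\<not> ?thesis"
  let ?T = "topspace (product_topology X UNIV)"
  obtain n \<tau> where xT: "x \<in> ?T" and \<tau>: "\<And>i. i < n \<Longrightarrow> borel_prob (X i) (\<tau> i)"
    and eq: "(\<integral>y. f y \<partial>(\<Pi>\<^sub>M i\<in>UNIV. if i < n then \<tau> i else return (borel_of (X i)) (x i))) = (\<integral>y. f y \<partial>\<mu>)"
    using x unfolding weak_approx_def by auto
  let ?R = "\<lambda>i. if i < n then \<tau> i else return (borel_of (X i)) (x i)"
  let ?P = "PiM UNIV ?R"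
  have R: "prob_space (?R i)" "sets (?R i) = sets (borel_of (X i))" for i
    using \<tau> xT by (auto simp: borel_prob_def PiE_iff intro!: prob_space_return)
  interpret prob_space ?P
    by (intro prob_space_PiM R)
  have sets_P: "sets ?P = sets (\<Pi>\<^sub>M i\<in>UNIV. borel_of (X i))"
    using R(2) by (intro sets_PiM_cong) auto
  have space_P: "space ?P = ?T"
    using sets_eq_imp_space_eq[OF sets_P] by (simp add: space_PiM)
  obtain K where K: "\<And>y. y \<in> ?T \<Longrightarrow> norm (f y) \<le> K"
    using bdd unfolding bounded_iff by auto
  have "integrable ?P f"
  proof (rule integrable_const_bound[of _ K])
    show "AE y in ?P. norm (f y) \<le> K"
      using K space_P by (intro AE_I2) auto
    show "f \<in> borel_measurable ?P"
      using f sets_P by (simp cong: measurable_cong_sets)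
  qed
  moreover have "AE y in ?P. (\<integral>y. f y \<partial>\<mu>) < f y"
  proof -
    have "AE y in ?P. y i = x i" if "i \<ge> n" for i
    proof (rule AE_PiM_component[of UNIV ?R i "\<lambda>v. v = x i"])
      have xi: "x i \<in> topspace (X i)"
        using xT by (auto simp: PiE_iff)
      have "closedin (X i) {x i}"
        using P xi
        by (intro closedin_Hausdorff_singleton metrizable_imp_Hausdorff_space Polish_space_metrizable)
      then have "topspace (X i) - {x i} \<in> sets (borel_of (X i))"
        by (intro openin_sets_borel_of) blast
      then have "space (borel_of (X i)) - (topspace (X i) - {x i}) \<in> sets (borel_of (X i))"
        by (rule sets.compl_sets)
      then have "{x i} \<in> sets (borel_of (X i))"
        using xi by (simp add: double_diff)
      then have "{v \<in> space (borel_of (X i)). v = x i} \<in> sets (borel_of (X i))"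
        using xi by (simp add: Collect_conv_if conj_commute)
      then have "AE v in return (borel_of (X i)) (x i). v = x i"
        using xi by (subst AE_return) (auto simp: pred_def)
      then show "AE v in ?R i. v = x i"
        using that by simp
    qed (use R in auto)
    then have "AE y in ?P. \<forall>i\<in>{n..}. y i = x i"
      by (subst AE_ball_countable) auto
    then show ?thesis
      using AE_space
    proof eventually_elim
      case (elim y)
      then have "y \<in> ?T" "\<forall>i\<ge>n. y i = x i"
        unfolding space_P by simp_all
      then show ?case
        using no not_le by blast
    qed
  qed
  ultimately have "(\<integral>y. f y \<partial>\<mu>) < (\<integral>y. f y \<partial>?P)"
    by (rule expectation_greater)
  with eq show False
    by simp
qed

lemma weak_approx_uminus: "weak_approx X \<epsilon> \<mu> (\<lambda>z. - f z) = weak_approx X \<epsilon> \<mu> f"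
  unfolding weak_approx_def by (simp add: abs_minus_commute)

text \<open>The tail class of such a point lies in the set where \<open>f\<close> exceeds its mean, and this set does
  not have full measure.\<close>

lemma null_set_of_no_lower_point:
  fixes X :: "nat \<Rightarrow> 'a topology" and f :: "(nat \<Rightarrow> 'a) \<Rightarrow> real"
  assumes \<sigma>: "\<And>i. borel_prob (X i) (\<sigma> i)"
    and f: "f \<in> borel_measurable (PiM UNIV \<sigma>)"
    and bdd: "bounded (f ` topspace (product_topology X UNIV))"
  shows "\<exists>N\<in>null_sets (PiM UNIV \<sigma>). {x \<in> topspace (product_topology X UNIV).
    \<not> (\<exists>n. \<exists>z\<in>topspace (product_topology X UNIV).
        f z \<le> (\<integral>y. f y \<partial>PiM UNIV \<sigma>) \<and> (\<forall>i\<ge>n. z i = x i))} \<subseteq> N"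
proof -
  let ?P = "PiM UNIV \<sigma>"
  let ?T = "topspace (product_topology X UNIV)"
  have \<sigma>p: "prob_space (\<sigma> i)" for i
    using \<sigma> by (simp add: borel_prob_def)
  interpret prob_space ?P
    by (intro prob_space_PiM \<sigma>p)
  have space_P: "space ?P = ?T"
    using borel_prob_space_eq[OF \<sigma>] by (simp add: space_PiM)
  define c where "c = (\<integral>y. f y \<partial>?P)"
  define B where "B = {z \<in> space ?P. c < f z}"
  have B: "B \<in> sets ?P"
    unfolding B_def using f by measurable
  obtain K where K: "\<And>y. y \<in> ?T \<Longrightarrow> norm (f y) \<le> K"
    using bdd unfolding bounded_iff by auto
  have "integrable ?P f"
    using K space_P f by (intro integrable_const_bound[of _ K] AE_I2) auto
  then have "\<not> (AE y in ?P. c < f y)"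
    using expectation_greater[of f c] by (auto simp: c_def)
  then have "prob B \<noteq> 1"
    using prob_Collect_eq_1[of "\<lambda>y. c < f y"] B by (simp add: B_def)
  then have "emeasure ?P B < 1"
    using prob_le_1[of B] by (simp add: emeasure_eq_measure less_le)
  then obtain N where N: "N \<in> null_sets ?P"
    "{x \<in> space ?P. \<forall>n. \<forall>y\<in>space ?P. graft n y x \<in> B} \<subseteq> N"
    using subset_tail_null[of \<sigma> B, OF \<sigma>p B] by blast
  have "x \<in> N" if x: "x \<in> ?T" and no: "\<not> (\<exists>n. \<exists>z\<in>?T. f z \<le> c \<and> (\<forall>i\<ge>n. z i = x i))" for x
  proof -
    have "graft n y x \<in> B" if "y \<in> space ?P" for n y
    proof -
      have g: "graft n y x \<in> space ?P"
        using that x by (intro graft_in_space) (auto simp: space_P)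
      moreover have "\<forall>i\<ge>n. graft n y x i = x i"
        by (simp add: graft_def)
      ultimately have "\<not> f (graft n y x) \<le> c"
        using no space_P by blast
      with g show ?thesis
        by (simp add: B_def)
    qed
    then show ?thesis
      using N(2) x space_P by blast
  qed
  then show ?thesis
    using N(1) unfolding c_def by blast
qed

theorem theorem4:
  fixes X :: "nat \<Rightarrow> 'a topology"
    and \<sigma> :: "nat \<Rightarrow> 'a measure"
    and f :: "(nat \<Rightarrow> 'a) \<Rightarrow> real"
  assumes "\<And>i. Polish_space (X i)"
    and "\<And>i. borel_prob (X i) (\<sigma> i)"
    and "f \<in> borel_measurable (borel_of (product_topology X UNIV))"
    and "bounded (f ` topspace (product_topology X UNIV))"
  shows "emeasure (universal_extension (product_topology X UNIV) (\<Pi>\<^sub>M i\<in>UNIV. \<sigma> i))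
           (weak_approx X 0 (\<Pi>\<^sub>M i\<in>UNIV. \<sigma> i) f) = 1"
proof -
  let ?P = "PiM UNIV \<sigma>"
  let ?T = "product_topology X UNIV"
  have bp: "borel_prob ?T ?P"
    using assms(1,2) by (rule borel_prob_PiM)
  then interpret prob_space ?P
    by (simp add: borel_prob_def)
  have sets_P: "sets ?P = sets (borel_of ?T)"
    using bp by (simp add: borel_prob_def)
  have space_P: "space ?P = topspace ?T"
    using bp by (rule borel_prob_space_eq)
  \<comment> \<open>The points whose tail class contains a point at which \<open>h\<close> is at most its mean. The set of
    approximations is the intersection of \<open>S f\<close> and \<open>S (- f)\<close>.\<close>
  define S where "S h = {x \<in> topspace ?T. \<exists>n. \<exists>z\<in>topspace ?T.
      h z \<le> (\<integral>y. h y \<partial>?P) \<and> (\<forall>i\<ge>n. z i = x i)}" for h :: "(nat \<Rightarrow> 'a) \<Rightarrow> real"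
  have S: "S h \<in> sets (universal_algebra ?T)" "\<exists>N\<in>null_sets ?P. topspace ?T - S h \<subseteq> N"
    "weak_approx X 0 ?P h \<subseteq> S h"
    if h: "h \<in> borel_measurable (borel_of ?T)" and bdd: "bounded (h ` topspace ?T)" for h
  proof -
    have hP: "h \<in> borel_measurable ?P" "h \<in> borel_measurable (\<Pi>\<^sub>M i\<in>UNIV. borel_of (X i))"
      using h sets_P sets_PiM_borel_of[of X, OF assms(1)] by (simp_all cong: measurable_cong_sets)
    let ?B = "{z \<in> topspace ?T. h z \<le> (\<integral>y. h y \<partial>?P)}"
    have "{z \<in> space (borel_of ?T). h z \<le> (\<integral>y. h y \<partial>?P)} \<in> sets (borel_of ?T)"
      using h by measurable
    then have "?B \<in> sets (borel_of ?T)"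
      by simp
    then have "{x \<in> topspace ?T. \<exists>n. \<exists>z\<in>?B. \<forall>i\<ge>n. z i = x i} \<in> sets (universal_algebra ?T)"
      using assms(1) by (intro eventual_agreement_universally_measurable)
    moreover have "S h = {x \<in> topspace ?T. \<exists>n. \<exists>z\<in>?B. \<forall>i\<ge>n. z i = x i}"
      unfolding S_def by blast
    ultimately show "S h \<in> sets (universal_algebra ?T)"
      by simp
    have "topspace ?T - S h = {x \<in> topspace ?T. \<not> (\<exists>n. \<exists>z\<in>topspace ?T.
        h z \<le> (\<integral>y. h y \<partial>?P) \<and> (\<forall>i\<ge>n. z i = x i))}"
      unfolding S_def by blast
    then show "\<exists>N\<in>null_sets ?P. topspace ?T - S h \<subseteq> N"
      using null_set_of_no_lower_point[of X \<sigma>, OF assms(2) hP(1) bdd] by simp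
    show "weak_approx X 0 ?P h \<subseteq> S h"
    proof
      fix x
      assume x: "x \<in> weak_approx X 0 ?P h"
      then have "x \<in> topspace ?T"
        by (simp add: weak_approx_def)
      then show "x \<in> S h"
        using weak_approx_lower_point[of X, OF assms(1) hP(2) bdd x] unfolding S_def by blast
    qed
  qed
  define f' where "f' = (\<lambda>z. - f z)"
  have f': "f' \<in> borel_measurable (borel_of ?T)" "bounded (f' ` topspace ?T)"
    using assms(3,4) unfolding f'_def by (auto simp: bounded_iff)
  have "weak_approx X 0 ?P f = weak_approx X 0 ?P f'"
    unfolding f'_def by (rule weak_approx_uminus[symmetric])
  then have sub: "weak_approx X 0 ?P f \<subseteq> S f \<inter> S f'"
    using S(3)[OF assms(3,4)] S(3)[OF f'] by simp
  have "S f \<inter> S f' \<subseteq> weak_approx X 0 ?P f"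
  proof
    fix x
    assume "x \<in> S f \<inter> S f'"
    then obtain m y n z where "x \<in> topspace ?T"
      "y \<in> topspace ?T" "f y \<le> (\<integral>y. f y \<partial>?P)" "\<forall>i\<ge>m. y i = x i"
      "z \<in> topspace ?T" "f' z \<le> (\<integral>y. f' y \<partial>?P)" "\<forall>i\<ge>n. z i = x i"
      unfolding S_def by blast
    moreover have "f \<in> borel_measurable (\<Pi>\<^sub>M i\<in>UNIV. borel_of (X i))"
      using assms(3) sets_PiM_borel_of[of X, OF assms(1)] by (simp cong: measurable_cong_sets)
    ultimately show "x \<in> weak_approx X 0 ?P f"
      by (intro weak_approx_of_crossing[of f X x y m _ z n]) (auto simp: f'_def)
  qed
  with sub have W: "weak_approx X 0 ?P f = S f \<inter> S f'"
    by blast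
  have W_sets: "S f \<inter> S f' \<in> sets (universal_algebra ?T)"
    using S(1)[OF assms(3,4)] S(1)[OF f'] by blast
  obtain N N' where N: "N \<in> null_sets ?P" "topspace ?T - S f \<subseteq> N"
    "N' \<in> null_sets ?P" "topspace ?T - S f' \<subseteq> N'"
    using S(2)[OF assms(3,4)] S(2)[OF f'] by blast
  have null: "N \<union> N' \<in> null_sets (completion ?P)"
    using N by (intro null_sets_completionI null_sets.Un)
  have W_compl: "S f \<inter> S f' \<in> sets (completion ?P)"
    using W_sets bp unfolding sets_universal_algebra by blast
  have "emeasure (completion ?P) (S f \<inter> S f') = emeasure (completion ?P) (S f \<inter> S f' \<union> (N \<union> N'))"
    using W_compl null by (rule emeasure_Un_null_set[symmetric])
  also have "S f \<inter> S f' \<union> (N \<union> N') = space ?P"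
  proof -
    have "N \<subseteq> space ?P" "N' \<subseteq> space ?P"
      using N by (auto dest!: null_setsD2 sets.sets_into_space)
    moreover have "S f \<subseteq> space ?P"
      by (auto simp: S_def space_P)
    ultimately show ?thesis
      using N(2,4) unfolding space_P by blast
  qed
  also have "emeasure (completion ?P) (space ?P) = 1"
    by (simp add: emeasure_space_1)
  finally show ?thesis
    using emeasure_universal_extension[OF bp W_sets] W by simp
qed

end
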